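(* Let $I\subseteq\mathbb{R}$ be a nonempty open interval, let $f:I\to\mathbb{R}$ be a continuous and strictly increasing function, and let $(\xi_n)_{n\in\mathbb{N}}$ be a sequence of exchangeable random variables with values in $I$. If $L:I\to\mathbb{R}$ is a function such that $L\circ f^{-1}$ is convex on $f(I)$ and $\mathbb{E}(|L(\xi_1)|)<\infty$, then $\mathbb{E}\big(L(\mathscr{A}_n^{f}(\xi_1,\ldots,\xi_n))\big)\in[-\infty,\infty)$ for all $n\in\mathbb{N}$, and the sequence $\Big(\mathbb{E}\big(L(\mathscr{A}_n^{f}(\xi_1,\ldots,\xi_n))\big)\Big)_{n\in\mathbb{N}}$ is decreasing.
   Context: $\mathbb{N}$ is the set of positive integers. Quasi-arithmetic mean: for a nonempty open interval $I$, a continuous strictly increasing $f:I\to\mathbb{R}$ with inverse $f^{-1}:f(I)\to I$, and $n\in\mathbb{N}$, $\mathscr{A}_n^{f}:I^n\to I$ is $\mathscr{A}_n^{f}(x_1,\ldots,x_n):=f^{-1}\big(\frac1n\sum_{i=1}^n f(x_i)\big)$. Exchangeability: a sequence $(\xi_n)_{n\in\mathbb{N}}$ of random variables is exchangeable if for every $n\in\mathbb{N}$ and every permutation $\sigma$ of $(1,\ldots,n)$ the law of $(\xi_{\sigma(1)},\ldots,\xi_{\sigma(n)})$ equals that of $(\xi_1,\ldots,\xi_n)$. "Decreasing" means non-increasing (with values in $[-\infty,\infty)$). An expectation is said to lie in $[-\infty,\infty)$ when the positive part is integrable, the expectation being $-\infty$ if the negative part is not integrable. *)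

theory Defs
  imports "HOL-Probability.Probability"
begin

text \<open>Index sets start at 1; a tuple \<open>(x\<^sub>1, \<dots>, x\<^sub>n)\<close> is given by the values of
  \<open>x :: nat \<Rightarrow> real\<close> on \<open>{1..n}\<close>, and the value \<open>x 0\<close> is never used.\<close>

definition quasi_arithmetic_mean ::
    "real set \<Rightarrow> (real \<Rightarrow> real) \<Rightarrow> nat \<Rightarrow> (nat \<Rightarrow> real) \<Rightarrow> real" where
  "quasi_arithmetic_mean I f n x = inv_into I f ((\<Sum>i = 1..n. f (x i)) / real n)"

definition exchangeable_seq :: "'a measure \<Rightarrow> (nat \<Rightarrow> 'a \<Rightarrow> real) \<Rightarrow> bool" where
  "exchangeable_seq M \<xi> \<longleftrightarrow>
     (\<forall>n\<ge>1. \<forall>\<sigma>. \<sigma> permutes {1..n} \<longrightarrow>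
        distr M (\<Pi>\<^sub>M i\<in>{1..n}. borel) (\<lambda>\<omega>. \<lambda>i\<in>{1..n}. \<xi> (\<sigma> i) \<omega>) =
        distr M (\<Pi>\<^sub>M i\<in>{1..n}. borel) (\<lambda>\<omega>. \<lambda>i\<in>{1..n}. \<xi> i \<omega>))"

text \<open>The expectation of \<open>X\<close> exists in \<open>[-\<infinity>, \<infinity>)\<close>: only the positive part has to be integrable.\<close>

definition expectation_below_infinity :: "'a measure \<Rightarrow> ('a \<Rightarrow> real) \<Rightarrow> bool" where
  "expectation_below_infinity M X \<longleftrightarrow>
     X \<in> borel_measurable M \<and> integrable M (\<lambda>\<omega>. max 0 (X \<omega>))"

text \<open>\<open>E X = E X\<^sup>+ - E X\<^sup>-\<close>; \<open>ennreal\<close> maps negative reals to 0, so the two integrands are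
  the positive and the negative part. If both integrals are infinite the value is a convention
  of \<open>ereal\<close> subtraction; \<^const>\<open>expectation_below_infinity\<close> excludes that case.\<close>

definition ext_expectation :: "'a measure \<Rightarrow> ('a \<Rightarrow> real) \<Rightarrow> ereal" where
  "ext_expectation M X =
     enn2ereal (\<integral>\<^sup>+ \<omega>. ennreal (X \<omega>) \<partial>M) - enn2ereal (\<integral>\<^sup>+ \<omega>. ennreal (- X \<omega>) \<partial>M)"

lemma ext_expectation_eq_integral:
  assumes "integrable M X"
  shows "ext_expectation M X = ereal (integral\<^sup>L M X)"
proof -
  have *: "(\<integral>\<^sup>+ \<omega>. ennreal (Y \<omega>) \<partial>M) < \<infinity>" if "integrable M Y" for Y :: "'a \<Rightarrow> real"
  proof -
    have "(\<integral>\<^sup>+ \<omega>. ennreal (Y \<omega>) \<partial>M) \<le> (\<integral>\<^sup>+ \<omega>. ennreal (norm (Y \<omega>)) \<partial>M)"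
      by (intro nn_integral_mono ennreal_leI) auto
    also have "\<dots> < \<infinity>" using that by (simp add: integrable_iff_bounded)
    finally show ?thesis .
  qed
  obtain a where a: "(\<integral>\<^sup>+ \<omega>. ennreal (X \<omega>) \<partial>M) = ennreal a" "0 \<le> a"
    using *[OF assms] by (cases "\<integral>\<^sup>+ \<omega>. ennreal (X \<omega>) \<partial>M") auto
  obtain b where b: "(\<integral>\<^sup>+ \<omega>. ennreal (- X \<omega>) \<partial>M) = ennreal b" "0 \<le> b"
    using *[of "\<lambda>\<omega>. - X \<omega>"] assms by (cases "\<integral>\<^sup>+ \<omega>. ennreal (- X \<omega>) \<partial>M") auto
  show ?thesis
    using a b by (simp add: ext_expectation_def real_lebesgue_integral_def[OF assms] enn2ereal_ennreal)
qed

lemma ext_expectation_less_top: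
  assumes "expectation_below_infinity M X"
  shows "ext_expectation M X < \<infinity>"
proof -
  have "(\<integral>\<^sup>+ \<omega>. ennreal (X \<omega>) \<partial>M) = (\<integral>\<^sup>+ \<omega>. ennreal (norm (max 0 (X \<omega>))) \<partial>M)"
    by (intro nn_integral_cong) (auto simp: max_def ennreal_neg)
  also have "\<dots> < \<infinity>"
    using assms by (simp add: expectation_below_infinity_def integrable_iff_bounded)
  finally obtain a where "(\<integral>\<^sup>+ \<omega>. ennreal (X \<omega>) \<partial>M) = ennreal a" "0 \<le> a"
    by (cases "\<integral>\<^sup>+ \<omega>. ennreal (X \<omega>) \<partial>M") auto
  then show ?thesis
    by (cases "\<integral>\<^sup>+ \<omega>. ennreal (- X \<omega>) \<partial>M") (auto simp: ext_expectation_def enn2ereal_ennreal)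
qed

lemma ext_expectation_eq_minus_infinity:
  assumes "expectation_below_infinity M X" "\<not> integrable M (\<lambda>\<omega>. max 0 (- X \<omega>))"
  shows "ext_expectation M X = - \<infinity>"
proof -
  have [measurable]: "X \<in> borel_measurable M"
    using assms(1) by (simp add: expectation_below_infinity_def)
  have "(\<integral>\<^sup>+ \<omega>. ennreal (- X \<omega>) \<partial>M) = (\<integral>\<^sup>+ \<omega>. ennreal (norm (max 0 (- X \<omega>))) \<partial>M)"
    by (intro nn_integral_cong) (auto simp: max_def ennreal_neg)
  also have "\<dots> = \<infinity>"
    using assms(2) by (auto simp: integrable_iff_bounded not_less top_unique)
  finally have "enn2ereal (\<integral>\<^sup>+ \<omega>. ennreal (- X \<omega>) \<partial>M) = \<infinity>" by simp
  then show ?thesis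
    using ext_expectation_less_top[OF assms(1)]
    by (cases "enn2ereal (\<integral>\<^sup>+ \<omega>. ennreal (X \<omega>) \<partial>M)") (auto simp: ext_expectation_def)
qed

end

theory Submission
  imports Defs
begin

text \<open>
  Put \<open>g = L \<circ> f\<^sup>-\<^sup>1\<close> and \<open>Y\<^sub>i = f(\<xi>\<^sub>i)\<close>. The sequence \<open>Y\<close> is again exchangeable, and
  \<open>L(A\<^sub>n(\<xi>\<^sub>1, \<dots>, \<xi>\<^sub>n)) = g(Z\<^sub>n)\<close> for the arithmetic mean \<open>Z\<^sub>n\<close> of \<open>Y\<^sub>1, \<dots>, Y\<^sub>n\<close>, so only
  arithmetic means and a convex \<open>g\<close> have to be considered.

  The mean \<open>Z\<^sub>n\<^sub>+\<^sub>1\<close> is the average of the \<open>n + 1\<close> means \<open>W\<^sub>k\<close> obtained by leaving out one of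
  \<open>Y\<^sub>1, \<dots>, Y\<^sub>n\<^sub>+\<^sub>1\<close>; convexity bounds \<open>g(Z\<^sub>n\<^sub>+\<^sub>1)\<close> by the average of the \<open>g(W\<^sub>k)\<close>
  (\<open>convex_on_mean_leave_one_out\<close>), and exchangeability gives every \<open>W\<^sub>k\<close> the law of \<open>Z\<^sub>n\<close>.
  Taking expectations yields the monotonicity.

  Integrability of \<open>g(Y\<^sub>1)\<close> bounds \<open>g(Z\<^sub>n)\<close> only from above: \<open>Y\<^sub>1\<close> itself need not be integrable, and
  the expectation of \<open>g(Z\<^sub>n)\<close> may be \<open>-\<infinity>\<close>. All quantities are
  therefore subtracted from one integrable bound \<open>H = \<bar>g(Y\<^sub>1)\<bar> + \<dots> + \<bar>g(Y\<^sub>n\<^sub>+\<^sub>1)\<bar>\<close>, which is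
  symmetric in the variables and dominates \<open>g(Z\<^sub>n\<^sub>+\<^sub>1)\<close> and every \<open>g(W\<^sub>k)\<close>. The differences are
  nonnegative, so their integrals in \<open>[0, \<infinity>]\<close> exist and are additive, and
  \<open>ext_expectation_eq_bound_minus\<close> translates the result back to \<open>E X = E H - E (H - X)\<close>.
\<close>

section \<open>Expectations of functions bounded above\<close>

text \<open>The identity \<open>(H - X) + X\<^sup>+ = H + X\<^sup>-\<close> involves nonnegative functions only. After
  integration the finite terms \<open>E H\<close> and \<open>E X\<^sup>+ \<le> E H\<close> may be moved to the other sides.\<close>

lemma ext_expectation_eq_bound_minus:
  assumes [measurable]: "X \<in> borel_measurable M" "H \<in> borel_measurable M"
    and le: "\<And>\<omega>. \<omega> \<in> space M \<Longrightarrow> X \<omega> \<le> H \<omega>"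
    and nonneg: "\<And>\<omega>. \<omega> \<in> space M \<Longrightarrow> 0 \<le> H \<omega>"
    and fin: "(\<integral>\<^sup>+ \<omega>. ennreal (H \<omega>) \<partial>M) < \<infinity>"
  shows "ext_expectation M X =
    enn2ereal (\<integral>\<^sup>+ \<omega>. ennreal (H \<omega>) \<partial>M) - enn2ereal (\<integral>\<^sup>+ \<omega>. ennreal (H \<omega> - X \<omega>) \<partial>M)"
proof -
  let ?h = "\<integral>\<^sup>+ \<omega>. ennreal (H \<omega>) \<partial>M" and ?d = "\<integral>\<^sup>+ \<omega>. ennreal (H \<omega> - X \<omega>) \<partial>M"
  let ?p = "\<integral>\<^sup>+ \<omega>. ennreal (X \<omega>) \<partial>M" and ?m = "\<integral>\<^sup>+ \<omega>. ennreal (- X \<omega>) \<partial>M"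
  have "?d + ?p = (\<integral>\<^sup>+ \<omega>. ennreal (H \<omega> - X \<omega>) + ennreal (X \<omega>) \<partial>M)"
    by (intro nn_integral_add[symmetric]) auto
  also have "\<dots> = (\<integral>\<^sup>+ \<omega>. ennreal (H \<omega>) + ennreal (- X \<omega>) \<partial>M)"
  proof (intro nn_integral_cong)
    fix \<omega> assume "\<omega> \<in> space M"
    with le nonneg have "X \<omega> \<le> H \<omega>" "0 \<le> H \<omega>" by auto
    then show "ennreal (H \<omega> - X \<omega>) + ennreal (X \<omega>) = ennreal (H \<omega>) + ennreal (- X \<omega>)"
      by (cases "0 \<le> X \<omega>") (auto simp: ennreal_neg simp flip: ennreal_plus)
  qed
  also have "\<dots> = ?h + ?m"
    by (intro nn_integral_add) auto
  finally have eq: "?d + ?p = ?h + ?m" .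
  have "?p \<le> ?h"
    using le by (intro nn_integral_mono ennreal_leI)
  then have p: "?p < \<infinity>" using fin by (rule le_less_trans)
  obtain h where h: "?h = ennreal h" "0 \<le> h" using fin by (cases ?h) auto
  obtain p where p: "?p = ennreal p" "0 \<le> p" using p by (cases ?p) auto
  show ?thesis
  proof (cases ?m)
    case (real m)
    with eq h p have "?d + ennreal p = ennreal (h + m)" by simp
    moreover from this obtain d where d: "?d = ennreal d" "0 \<le> d" by (cases ?d) auto
    ultimately have "d + p = h + m"
      using h p real by (simp flip: ennreal_plus)
    then show ?thesis
      using h p d real by (simp add: ext_expectation_def enn2ereal_ennreal)
  next
    case top
    with eq p have "?d = \<infinity>" by (cases ?d) (auto simp flip: ennreal_plus)
    then show ?thesis
      using h p top by (simp add: ext_expectation_def enn2ereal_ennreal)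
  qed
qed

lemma expectation_below_infinity_bounded:
  assumes [measurable]: "X \<in> borel_measurable M" and "integrable M H"
    and "\<And>\<omega>. \<omega> \<in> space M \<Longrightarrow> X \<omega> \<le> H \<omega>"
    and "\<And>\<omega>. \<omega> \<in> space M \<Longrightarrow> 0 \<le> H \<omega>"
  shows "expectation_below_infinity M X"
  unfolding expectation_below_infinity_def
proof
  show "integrable M (\<lambda>\<omega>. max 0 (X \<omega>))"
    using assms by (intro Bochner_Integration.integrable_bound[OF assms(2)] AE_I2) auto
qed fact

lemma expectation_below_infinity_cong:
  assumes "\<And>\<omega>. \<omega> \<in> space M \<Longrightarrow> X \<omega> = X' \<omega>"
  shows "expectation_below_infinity M X \<longleftrightarrow> expectation_below_infinity M X'"
  using assms unfolding expectation_below_infinity_def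
  by (intro conj_cong measurable_cong Bochner_Integration.integrable_cong) auto

lemma ext_expectation_cong:
  assumes "\<And>\<omega>. \<omega> \<in> space M \<Longrightarrow> X \<omega> = X' \<omega>"
  shows "ext_expectation M X = ext_expectation M X'"
  using assms unfolding ext_expectation_def
  by (intro arg_cong2[where f = minus] arg_cong[where f = enn2ereal] nn_integral_cong) auto

section \<open>Exchangeable sequences\<close>

lemma exchangeable_seq_nn_integral:
  assumes "exchangeable_seq M Y" and "n \<ge> 1" and "\<sigma> permutes {1..n}"
    and [measurable]: "\<And>i. i \<ge> 1 \<Longrightarrow> Y i \<in> borel_measurable M"
    and [measurable]: "\<Phi> \<in> borel_measurable (\<Pi>\<^sub>M i\<in>{1..n}. (borel :: real measure))"
  shows "(\<integral>\<^sup>+ \<omega>. \<Phi> (\<lambda>i\<in>{1..n}. Y (\<sigma> i) \<omega>) \<partial>M) = (\<integral>\<^sup>+ \<omega>. \<Phi> (\<lambda>i\<in>{1..n}. Y i \<omega>) \<partial>M)"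
proof -
  let ?P = "\<Pi>\<^sub>M i\<in>{1..n}. (borel :: real measure)"
  have meas: "(\<lambda>\<omega>. \<lambda>i\<in>{1..n}. Y (\<tau> i) \<omega>) \<in> measurable M ?P" if "\<tau> permutes {1..n}" for \<tau>
    using permutes_in_image[OF that] by (intro measurable_restrict assms(4)) (metis atLeastAtMost_iff)
  have "(\<integral>\<^sup>+ \<omega>. \<Phi> (\<lambda>i\<in>{1..n}. Y (\<sigma> i) \<omega>) \<partial>M) =
      (\<integral>\<^sup>+ x. \<Phi> x \<partial>distr M ?P (\<lambda>\<omega>. \<lambda>i\<in>{1..n}. Y (\<sigma> i) \<omega>))"
    using meas[OF assms(3)] assms(5) by (subst nn_integral_distr) auto
  also have "\<dots> = (\<integral>\<^sup>+ x. \<Phi> x \<partial>distr M ?P (\<lambda>\<omega>. \<lambda>i\<in>{1..n}. Y i \<omega>))"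
    using assms(1-3) by (simp add: exchangeable_seq_def)
  also have "\<dots> = (\<integral>\<^sup>+ \<omega>. \<Phi> (\<lambda>i\<in>{1..n}. Y i \<omega>) \<partial>M)"
    using meas[OF permutes_id] assms(5) by (subst nn_integral_distr) auto
  finally show ?thesis .
qed

text \<open>All variables have the law of the first, as the transposition of \<open>1\<close> and \<open>i\<close> shows.\<close>

lemma exchangeable_seq_nn_integral_same:
  assumes "exchangeable_seq M Y" and "i \<ge> 1"
    and "\<And>i. i \<ge> 1 \<Longrightarrow> Y i \<in> borel_measurable M"
    and [measurable]: "h \<in> borel_measurable borel"
  shows "(\<integral>\<^sup>+ \<omega>. h (Y i \<omega>) \<partial>M) = (\<integral>\<^sup>+ \<omega>. h (Y 1 \<omega>) \<partial>M)"
proof -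
  have "Transposition.transpose 1 i permutes {1..i}"
    by (intro permutes_swap_id) (use assms(2) in auto)
  moreover have "(\<lambda>x. h (x 1)) \<in> borel_measurable (\<Pi>\<^sub>M i\<in>{1..i}. (borel :: real measure))"
    by (rule measurable_compose[OF _ assms(4)], rule measurable_component_singleton)
      (use assms(2) in simp)
  ultimately show ?thesis
    using exchangeable_seq_nn_integral[OF assms(1,2) _ assms(3), of "Transposition.transpose 1 i" "\<lambda>x. h (x 1)"]
      assms(2) by simp
qed

lemma exchangeable_seq_comp:
  assumes ex: "exchangeable_seq M Y"
    and meas: "\<And>i. i \<ge> 1 \<Longrightarrow> Y i \<in> borel_measurable M"
    and F [measurable]: "F \<in> borel_measurable borel"
  shows "exchangeable_seq M (\<lambda>i \<omega>. F (Y i \<omega>))"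
  unfolding exchangeable_seq_def
proof (intro allI impI)
  fix n :: nat and \<sigma> assume n: "n \<ge> 1" and \<sigma>: "\<sigma> permutes {1..n}"
  let ?P = "\<Pi>\<^sub>M i\<in>{1..n}. (borel :: real measure)"
  let ?F = "\<lambda>x. \<lambda>i\<in>{1..n}. F (x i)"
  have F': "?F \<in> measurable ?P ?P" by measurable
  have *: "distr M ?P (\<lambda>\<omega>. \<lambda>i\<in>{1..n}. F (Y (\<tau> i) \<omega>)) =
      distr (distr M ?P (\<lambda>\<omega>. \<lambda>i\<in>{1..n}. Y (\<tau> i) \<omega>)) ?P ?F" if "\<tau> permutes {1..n}" for \<tau>
  proof -
    have "(\<lambda>\<omega>. \<lambda>i\<in>{1..n}. Y (\<tau> i) \<omega>) \<in> measurable M ?P"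
      using permutes_in_image[OF that] by (intro measurable_restrict meas) (metis atLeastAtMost_iff)
    from distr_distr[OF F' this] show ?thesis
      by (simp add: comp_def cong: restrict_cong)
  qed
  show "distr M ?P (\<lambda>\<omega>. \<lambda>i\<in>{1..n}. F (Y (\<sigma> i) \<omega>)) = distr M ?P (\<lambda>\<omega>. \<lambda>i\<in>{1..n}. F (Y i \<omega>))"
    using *[OF \<sigma>] *[OF permutes_id] ex n \<sigma> by (simp add: exchangeable_seq_def)
qed

section \<open>Convex functions of arithmetic means\<close>

lemma convex_mean_mem:
  assumes "convex J" and "n \<ge> 1" and "\<And>i. i \<in> {1..n} \<Longrightarrow> (y i :: real) \<in> J"
  shows "(\<Sum>i=1..n. y i) / real n \<in> J"
proof -
  have "(\<Sum>i=1..n. (1 / real n) *\<^sub>R y i) \<in> J"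
    using assms by (intro convex_sum) auto
  then show ?thesis by (simp add: sum_divide_distrib)
qed

lemma convex_on_mean_le:
  assumes "convex_on J g" and "n \<ge> 1" and "\<And>i. i \<in> {1..n} \<Longrightarrow> (y i :: real) \<in> J"
  shows "g ((\<Sum>i=1..n. y i) / real n) \<le> (\<Sum>i=1..n. g (y i)) / real n"
proof -
  have "g (\<Sum>i=1..n. (1 / real n) *\<^sub>R y i) \<le> (\<Sum>i=1..n. (1 / real n) * g (y i))"
    using assms by (intro convex_on_sum) (auto simp: convex_on_imp_convex)
  then show ?thesis by (simp add: sum_divide_distrib)
qed

lemma convex_on_mean_le_sum_abs:
  assumes "convex_on J g" and "n \<ge> 1" and "\<And>i. i \<in> {1..n} \<Longrightarrow> (y i :: real) \<in> J"
  shows "g ((\<Sum>i=1..n. y i) / real n) \<le> (\<Sum>i=1..n. \<bar>g (y i)\<bar>)"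
proof -
  have "(\<Sum>i=1..n. g (y i)) / real n \<le> (\<Sum>i=1..n. \<bar>g (y i)\<bar>) / real n"
    by (intro divide_right_mono sum_mono) auto
  also have "\<dots> \<le> (\<Sum>i=1..n. \<bar>g (y i)\<bar>) / 1"
    using assms(2) by (intro divide_left_mono) (auto intro: sum_nonneg)
  finally show ?thesis
    using convex_on_mean_le[of J g n y] assms by simp
qed

lemma sum_transpose_last:
  fixes h :: "nat \<Rightarrow> real"
  assumes "k \<in> {1..Suc n}"
  shows "(\<Sum>i=1..n. h (Transposition.transpose k (Suc n) i)) = (\<Sum>i=1..Suc n. h i) - h k"
proof -
  have "Transposition.transpose k (Suc n) permutes {1..Suc n}"
    using assms by (intro permutes_swap_id) auto
  then have "(\<Sum>i=1..Suc n. h i) = (\<Sum>i=1..Suc n. h (Transposition.transpose k (Suc n) i))"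
    by (simp add: sum.permute[of _ _ h] comp_def del: sum.cl_ivl_Suc)
  then show ?thesis by simp
qed

text \<open>Each of the \<open>n + 1\<close> numbers occurs in exactly \<open>n\<close> of the means that leave one number out,
  so the full mean is the average of these means. The \<open>k\<close>-th number is left out by moving it to the
  last position with a transposition, the form in which exchangeability applies.\<close>

lemma convex_on_mean_leave_one_out:
  assumes "convex_on J g" and n: "n \<ge> 1" and y: "\<And>i. i \<in> {1..Suc n} \<Longrightarrow> (y i :: real) \<in> J"
  shows "g ((\<Sum>i=1..Suc n. y i) / real (Suc n)) \<le>
    (\<Sum>k=1..Suc n. g ((\<Sum>i=1..n. y (Transposition.transpose k (Suc n) i)) / real n)) / real (Suc n)"
proof -
  let ?s = "\<Sum>i=1..Suc n. y i"
  let ?w = "\<lambda>k. (\<Sum>i=1..n. y (Transposition.transpose k (Suc n) i)) / real n"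
  have "?w k \<in> J" if "k \<in> {1..Suc n}" for k
    using that n by (intro convex_mean_mem convex_on_imp_convex[OF assms(1)] y)
      (auto simp: Transposition.transpose_def)
  then have "g ((\<Sum>k=1..Suc n. ?w k) / real (Suc n)) \<le> (\<Sum>k=1..Suc n. g (?w k)) / real (Suc n)"
    by (intro convex_on_mean_le[OF assms(1)]) auto
  moreover have "(\<Sum>k=1..Suc n. ?w k) = (\<Sum>k=1..Suc n. (?s - y k) / real n)"
    by (intro sum.cong refl) (simp only: sum_transpose_last)
  then have "(\<Sum>k=1..Suc n. ?w k) = (real (Suc n) * ?s - ?s) / real n"
    by (simp only: sum_subtractf flip: sum_divide_distrib) simp
  then have "(\<Sum>k=1..Suc n. ?w k) = ?s"
    using n by (simp add: field_simps)
  ultimately show ?thesis by simp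
qed

section \<open>Arithmetic means of an exchangeable sequence\<close>

lemma exchangeable_seq_integrable_sum_abs:
  assumes ex: "exchangeable_seq M Y"
    and meas: "\<And>i. i \<ge> 1 \<Longrightarrow> Y i \<in> borel_measurable M"
    and g [measurable]: "g \<in> borel_measurable borel"
    and fin: "(\<integral>\<^sup>+ \<omega>. ennreal \<bar>g (Y 1 \<omega>)\<bar> \<partial>M) < \<infinity>"
  shows "integrable M (\<lambda>\<omega>. \<Sum>i=1..n. \<bar>g (Y i \<omega>)\<bar>)"
proof (intro Bochner_Integration.integrable_sum integrable_abs)
  fix i assume "i \<in> {1..n}"
  then have i: "i \<ge> 1" by simp
  note [measurable] = meas[OF i]
  have "(\<integral>\<^sup>+ \<omega>. ennreal \<bar>g (Y i \<omega>)\<bar> \<partial>M) = (\<integral>\<^sup>+ \<omega>. ennreal \<bar>g (Y 1 \<omega>)\<bar> \<partial>M)"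
    by (rule exchangeable_seq_nn_integral_same[OF ex i meas, where h = "\<lambda>t. ennreal \<bar>g t\<bar>"]) auto
  then show "integrable M (\<lambda>\<omega>. g (Y i \<omega>))"
    using fin by (simp add: integrable_iff_bounded)
qed

lemma expectation_below_infinity_convex_mean:
  assumes ex: "exchangeable_seq M Y"
    and meas [measurable]: "\<And>i. i \<ge> 1 \<Longrightarrow> Y i \<in> borel_measurable M"
    and J: "\<And>i \<omega>. i \<ge> 1 \<Longrightarrow> \<omega> \<in> space M \<Longrightarrow> Y i \<omega> \<in> J"
    and g: "convex_on J g" and [measurable]: "g \<in> borel_measurable borel"
    and fin: "(\<integral>\<^sup>+ \<omega>. ennreal \<bar>g (Y 1 \<omega>)\<bar> \<partial>M) < \<infinity>"
    and n: "n \<ge> 1"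
  shows "expectation_below_infinity M (\<lambda>\<omega>. g ((\<Sum>i=1..n. Y i \<omega>) / real n))"
proof (rule expectation_below_infinity_bounded)
  have "(\<lambda>\<omega>. \<Sum>i=1..n. Y i \<omega>) \<in> borel_measurable M"
    by (intro borel_measurable_sum meas) simp
  then show "(\<lambda>\<omega>. g ((\<Sum>i=1..n. Y i \<omega>) / real n)) \<in> borel_measurable M"
    by measurable
  show "integrable M (\<lambda>\<omega>. \<Sum>i=1..n. \<bar>g (Y i \<omega>)\<bar>)"
    by (intro exchangeable_seq_integrable_sum_abs ex meas fin) auto
  show "g ((\<Sum>i=1..n. Y i \<omega>) / real n) \<le> (\<Sum>i=1..n. \<bar>g (Y i \<omega>)\<bar>)" if "\<omega> \<in> space M" for \<omega>
    using J that n by (intro convex_on_mean_le_sum_abs[OF g]) auto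
qed (auto intro: sum_nonneg)

text \<open>Let \<open>Z\<^sub>n\<close> be the mean of \<open>Y\<^sub>1, \<dots>, Y\<^sub>n\<close>, let \<open>W\<^sub>k\<close> be the mean of \<open>Y\<^sub>1, \<dots>, Y\<^sub>n\<^sub>+\<^sub>1\<close> without
  \<open>Y\<^sub>k\<close>, and let \<open>H = \<bar>g(Y\<^sub>1)\<bar> + \<dots> + \<bar>g(Y\<^sub>n\<^sub>+\<^sub>1)\<bar>\<close>. The bound \<open>H\<close> is invariant under permutations of the first \<open>n + 1\<close> variables. Hence the
  integral of \<open>H - g(W\<^sub>k)\<close> does not depend on \<open>k\<close>, and for \<open>k = n + 1\<close> it is that of
  \<open>H - g(Z\<^sub>n)\<close>. By convexity the average of the \<open>H - g(W\<^sub>k)\<close> is at most \<open>H - g(Z\<^sub>n\<^sub>+\<^sub>1)\<close>. In the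
  code \<open>X m\<close> is \<open>g(Z\<^sub>m)\<close> and \<open>W k\<close> is \<open>g(W\<^sub>k)\<close>.\<close>

lemma ext_expectation_convex_mean_Suc_le:
  assumes ex: "exchangeable_seq M Y"
    and meas: "\<And>i. i \<ge> 1 \<Longrightarrow> Y i \<in> borel_measurable M"
    and J: "\<And>i \<omega>. i \<ge> 1 \<Longrightarrow> \<omega> \<in> space M \<Longrightarrow> Y i \<omega> \<in> J"
    and g: "convex_on J g" and g_meas [measurable]: "g \<in> borel_measurable borel"
    and fin: "(\<integral>\<^sup>+ \<omega>. ennreal \<bar>g (Y 1 \<omega>)\<bar> \<partial>M) < \<infinity>"
    and n: "n \<ge> 1"
  shows "ext_expectation M (\<lambda>\<omega>. g ((\<Sum>i=1..Suc n. Y i \<omega>) / real (Suc n))) \<le>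
    ext_expectation M (\<lambda>\<omega>. g ((\<Sum>i=1..n. Y i \<omega>) / real n))"
proof -
  define \<sigma> where "\<sigma> k = Transposition.transpose k (Suc n)" for k
  define H where "H = (\<lambda>\<omega>. \<Sum>i=1..Suc n. \<bar>g (Y i \<omega>)\<bar>)"
  define W where "W k = (\<lambda>\<omega>. g ((\<Sum>i=1..n. Y (\<sigma> k i) \<omega>) / real n))" for k
  define X where "X m = (\<lambda>\<omega>. g ((\<Sum>i=1..m. Y i \<omega>) / real m))" for m
  have \<sigma>: "\<sigma> k permutes {1..Suc n}" if "k \<in> {1..Suc n}" for k
    using that unfolding \<sigma>_def by (intro permutes_swap_id) auto
  have \<sigma>_ge: "\<sigma> k i \<ge> 1" if "k \<ge> 1" "i \<ge> 1" for k i
    using that by (auto simp: \<sigma>_def Transposition.transpose_def)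
  have H_int: "integrable M H"
    unfolding H_def by (intro exchangeable_seq_integrable_sum_abs ex meas fin) auto
  then have H_fin: "(\<integral>\<^sup>+ \<omega>. ennreal (H \<omega>) \<partial>M) < \<infinity>"
    using integrableD(2)[OF H_int] by (simp add: less_top H_def)
  have H_nonneg: "0 \<le> H \<omega>" for \<omega>
    unfolding H_def by (intro sum_nonneg) auto
  have [measurable]: "H \<in> borel_measurable M"
    using H_int by auto
  have mean_meas: "(\<lambda>\<omega>. g ((\<Sum>i=1..m. Y (s i) \<omega>) / real m)) \<in> borel_measurable M"
    if "\<And>i. i \<ge> 1 \<Longrightarrow> s i \<ge> 1" for m s
  proof -
    have "(\<lambda>\<omega>. \<Sum>i=1..m. Y (s i) \<omega>) \<in> borel_measurable M"
      by (intro borel_measurable_sum meas that) simp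
    then show ?thesis by measurable
  qed
  have X_meas [measurable]: "X m \<in> borel_measurable M" for m
    using mean_meas[of "\<lambda>i. i" m] by (simp add: X_def)
  have W_meas: "W k \<in> borel_measurable M" if "k \<ge> 1" for k
    unfolding W_def using mean_meas[of "\<sigma> k" n] \<sigma>_ge[OF that] by simp
  have X_Suc_le: "X (Suc n) \<omega> \<le> H \<omega>" if "\<omega> \<in> space M" for \<omega>
    unfolding X_def H_def using J that by (intro convex_on_mean_le_sum_abs[OF g]) auto
  have W_le: "W k \<omega> \<le> H \<omega>" if "\<omega> \<in> space M" "k \<in> {1..Suc n}" for k \<omega>
  proof -
    have "W k \<omega> \<le> (\<Sum>i=1..n. \<bar>g (Y (\<sigma> k i) \<omega>)\<bar>)"
      unfolding W_def using J that n \<sigma>_ge by (intro convex_on_mean_le_sum_abs[OF g]) auto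
    also have "\<dots> = H \<omega> - \<bar>g (Y k \<omega>)\<bar>"
      unfolding H_def \<sigma>_def by (rule sum_transpose_last[OF that(2)])
    finally show ?thesis by simp
  qed
  have X_eq_W: "X n = W (Suc n)"
    by (simp add: X_def W_def \<sigma>_def)
  let ?c = "\<integral>\<^sup>+ \<omega>. ennreal (H \<omega> - X n \<omega>) \<partial>M"
  have same: "(\<integral>\<^sup>+ \<omega>. ennreal (H \<omega> - W k \<omega>) \<partial>M) = ?c" if k: "k \<in> {1..Suc n}" for k
  proof -
    define \<Phi> where "\<Phi> x = ennreal ((\<Sum>i=1..Suc n. \<bar>g (x i)\<bar>) - g ((\<Sum>i=1..n. x i) / real n))"
      for x :: "nat \<Rightarrow> real"
    have \<Phi>_meas: "\<Phi> \<in> borel_measurable (\<Pi>\<^sub>M i\<in>{1..Suc n}. (borel :: real measure))"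
    proof -
      have [measurable]: "(\<lambda>x. x i) \<in> borel_measurable (\<Pi>\<^sub>M i\<in>{1..Suc n}. (borel :: real measure))"
        if "i \<in> {1..Suc n}" for i
        using that by (rule measurable_component_singleton)
      have [measurable]: "(\<lambda>x. \<Sum>i=1..Suc n. \<bar>g (x i)\<bar>)
          \<in> borel_measurable (\<Pi>\<^sub>M i\<in>{1..Suc n}. (borel :: real measure))"
        by (rule borel_measurable_sum) measurable
      have [measurable]: "(\<lambda>x. \<Sum>i=1..n. x i)
          \<in> borel_measurable (\<Pi>\<^sub>M i\<in>{1..Suc n}. (borel :: real measure))"
        by (rule borel_measurable_sum) simp
      show ?thesis unfolding \<Phi>_def by measurable
    qed
    have H_perm: "(\<Sum>i=1..Suc n. \<bar>g (Y (\<sigma> k i) \<omega>)\<bar>) = H \<omega>" for \<omega>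
      unfolding H_def using sum.permute[OF \<sigma>[OF k], of "\<lambda>i. \<bar>g (Y i \<omega>)\<bar>"] by (simp only: comp_def)
    have "\<Phi> (\<lambda>i\<in>{1..Suc n}. Y (\<sigma> k i) \<omega>) = ennreal (H \<omega> - W k \<omega>)" for \<omega>
      unfolding \<Phi>_def W_def by (simp add: H_perm[symmetric])
    moreover have "\<Phi> (\<lambda>i\<in>{1..Suc n}. Y i \<omega>) = ennreal (H \<omega> - X n \<omega>)" for \<omega>
      unfolding \<Phi>_def X_def H_def by simp
    ultimately show ?thesis
      using exchangeable_seq_nn_integral[OF ex _ \<sigma>[OF k] meas \<Phi>_meas] by simp
  qed
  let ?q = "1 / real (Suc n)"
  have "?c = (\<Sum>k=1..Suc n. ennreal ?q * ?c)"
    by (simp add: ennreal_of_nat_eq_real_of_nat flip: mult.assoc ennreal_mult del: of_nat_Suc sum.cl_ivl_Suc)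
  also have "\<dots> = (\<Sum>k=1..Suc n. \<integral>\<^sup>+ \<omega>. ennreal ?q * ennreal (H \<omega> - W k \<omega>) \<partial>M)"
  proof (intro sum.cong refl)
    fix k assume k: "k \<in> {1..Suc n}"
    then have [measurable]: "W k \<in> borel_measurable M" by (intro W_meas) simp
    show "ennreal ?q * ?c = (\<integral>\<^sup>+ \<omega>. ennreal ?q * ennreal (H \<omega> - W k \<omega>) \<partial>M)"
      by (subst nn_integral_cmult) (simp_all only: same[OF k], measurable)
  qed
  also have "\<dots> = (\<integral>\<^sup>+ \<omega>. (\<Sum>k=1..Suc n. ennreal ?q * ennreal (H \<omega> - W k \<omega>)) \<partial>M)"
  proof (intro nn_integral_sum[symmetric])
    fix k assume "k \<in> {1..Suc n}"
    then have [measurable]: "W k \<in> borel_measurable M" by (intro W_meas) simp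
    show "(\<lambda>\<omega>. ennreal ?q * ennreal (H \<omega> - W k \<omega>)) \<in> borel_measurable M" by measurable
  qed
  also have "\<dots> \<le> (\<integral>\<^sup>+ \<omega>. ennreal (H \<omega> - X (Suc n) \<omega>) \<partial>M)"
  proof (intro nn_integral_mono)
    fix \<omega> assume \<omega>: "\<omega> \<in> space M"
    have "X (Suc n) \<omega> \<le> (\<Sum>k=1..Suc n. W k \<omega>) / real (Suc n)"
      unfolding X_def W_def \<sigma>_def using J \<omega> by (intro convex_on_mean_leave_one_out[OF g n]) auto
    then have "?q * (\<Sum>k=1..Suc n. H \<omega> - W k \<omega>) \<le> H \<omega> - X (Suc n) \<omega>"
      by (simp add: sum_subtractf field_simps del: sum.cl_ivl_Suc)
    then have "ennreal (\<Sum>k=1..Suc n. ?q * (H \<omega> - W k \<omega>)) \<le> ennreal (H \<omega> - X (Suc n) \<omega>)"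
      by (intro ennreal_leI) (simp only: sum_distrib_left)
    moreover have "(\<Sum>k=1..Suc n. ennreal ?q * ennreal (H \<omega> - W k \<omega>)) =
        (\<Sum>k=1..Suc n. ennreal (?q * (H \<omega> - W k \<omega>)))"
      by (intro sum.cong refl ennreal_mult[symmetric]) (use W_le[OF \<omega>] in auto)
    moreover have "\<dots> = ennreal (\<Sum>k=1..Suc n. ?q * (H \<omega> - W k \<omega>))"
      using W_le[OF \<omega>] by (intro sum_ennreal mult_nonneg_nonneg) auto
    ultimately show "(\<Sum>k=1..Suc n. ennreal ?q * ennreal (H \<omega> - W k \<omega>))
        \<le> ennreal (H \<omega> - X (Suc n) \<omega>)"
      by simp
  qed
  finally have "?c \<le> (\<integral>\<^sup>+ \<omega>. ennreal (H \<omega> - X (Suc n) \<omega>) \<partial>M)" .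
  then have "enn2ereal (\<integral>\<^sup>+ \<omega>. ennreal (H \<omega>) \<partial>M) - enn2ereal (\<integral>\<^sup>+ \<omega>. ennreal (H \<omega> - X (Suc n) \<omega>) \<partial>M)
      \<le> enn2ereal (\<integral>\<^sup>+ \<omega>. ennreal (H \<omega>) \<partial>M) - enn2ereal ?c"
    by (intro ereal_minus_mono) (auto simp: less_eq_ennreal.rep_eq)
  moreover have "X n \<omega> \<le> H \<omega>" if "\<omega> \<in> space M" for \<omega>
    unfolding X_eq_W using that by (intro W_le) auto
  ultimately have "ext_expectation M (X (Suc n)) \<le> ext_expectation M (X n)"
    using X_Suc_le H_nonneg H_fin by (subst (1 2) ext_expectation_eq_bound_minus[where H = H]) auto
  then show ?thesis by (simp only: X_def)
qed

section \<open>Quasi-arithmetic means\<close>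

theorem theorem4p2:
  fixes I :: "real set" and f L :: "real \<Rightarrow> real"
    and M :: "'a measure" and \<xi> :: "nat \<Rightarrow> 'a \<Rightarrow> real"
  assumes "I \<noteq> {}" and "open I" and "is_interval I"
    and "continuous_on I f" and "strict_mono_on I f"
    and "prob_space M"
    and "\<And>n. n \<ge> 1 \<Longrightarrow> \<xi> n \<in> borel_measurable M"
    and "\<And>n \<omega>. n \<ge> 1 \<Longrightarrow> \<omega> \<in> space M \<Longrightarrow> \<xi> n \<omega> \<in> I"
    and "exchangeable_seq M \<xi>"
    and "convex_on (f ` I) (L \<circ> inv_into I f)"
    and "(\<integral>\<^sup>+ \<omega>. ennreal \<bar>L (\<xi> 1 \<omega>)\<bar> \<partial>M) < \<infinity>"
  shows "(\<forall>n\<ge>1. expectation_below_infinity M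
            (\<lambda>\<omega>. L (quasi_arithmetic_mean I f n (\<lambda>i. \<xi> i \<omega>)))) \<and>
         antimono_on {1..} (\<lambda>n. ext_expectation M
            (\<lambda>\<omega>. L (quasi_arithmetic_mean I f n (\<lambda>i. \<xi> i \<omega>))))"
proof -
  \<comment> \<open>Extending \<open>f\<close> and \<open>L \<circ> f\<^sup>-\<^sup>1\<close> by 0 makes them Borel functions on the whole line, as needed
    for integrals with respect to laws on \<open>\<real>\<^sup>n\<close>.\<close>
  define F where "F x = (if x \<in> I then f x else 0)" for x
  define g where "g y = (if y \<in> f ` I then (L \<circ> inv_into I f) y else 0)" for y
  have inj: "inj_on f I"
    using assms(5) by (rule strict_mono_on_imp_inj_on)
  \<comment> \<open>Openness of \<open>f(I)\<close> makes the convex function on it continuous, hence Borel.\<close>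
  have open_J: "open (f ` I)"
    using assms(4,2) inj by (rule invariance_of_domain)
  have F_meas: "F \<in> borel_measurable borel"
    unfolding F_def using assms(2,4) by (intro borel_measurable_continuous_on_if) auto
  have g_meas: "g \<in> borel_measurable borel"
    unfolding g_def using open_J convex_on_continuous[OF open_J assms(10)]
    by (intro borel_measurable_continuous_on_if) auto
  have g_convex: "convex_on (f ` I) g"
  proof -
    have J: "convex (f ` I)"
      using assms(10) by (rule convex_on_imp_convex)
    show ?thesis
    proof (rule convex_onI[OF _ J])
      fix t x y :: real assume t: "0 < t" "t < 1" and xy: "x \<in> f ` I" "y \<in> f ` I"
      then have "(1 - t) *\<^sub>R x + t *\<^sub>R y \<in> f ` I"
        by (intro convexD[OF J]) auto
      then show "g ((1 - t) *\<^sub>R x + t *\<^sub>R y) \<le> (1 - t) * g x + t * g y"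
        using convex_onD[OF assms(10) _ _ xy, of t] t xy unfolding g_def by (simp only: if_True)
    qed
  qed
  let ?Y = "\<lambda>i \<omega>. F (\<xi> i \<omega>)"
  have Y_ex: "exchangeable_seq M ?Y"
    using assms(9,7) F_meas by (rule exchangeable_seq_comp)
  have Y_meas: "?Y i \<in> borel_measurable M" if "i \<ge> 1" for i
    using F_meas assms(7)[OF that] by measurable
  have Y_mem: "?Y i \<omega> \<in> f ` I" if "i \<ge> 1" "\<omega> \<in> space M" for i \<omega>
    using assms(8)[OF that] by (simp add: F_def)
  have "(\<integral>\<^sup>+ \<omega>. ennreal \<bar>g (?Y 1 \<omega>)\<bar> \<partial>M) = (\<integral>\<^sup>+ \<omega>. ennreal \<bar>L (\<xi> 1 \<omega>)\<bar> \<partial>M)"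
    using assms(8) inj by (intro nn_integral_cong) (simp add: F_def g_def)
  then have Y_fin: "(\<integral>\<^sup>+ \<omega>. ennreal \<bar>g (?Y 1 \<omega>)\<bar> \<partial>M) < \<infinity>"
    using assms(11) by simp
  have eq: "L (quasi_arithmetic_mean I f n (\<lambda>i. \<xi> i \<omega>)) = g ((\<Sum>i=1..n. ?Y i \<omega>) / real n)"
    if n: "n \<ge> 1" and \<omega>: "\<omega> \<in> space M" for n \<omega>
  proof -
    have "(\<Sum>i=1..n. ?Y i \<omega>) / real n \<in> f ` I"
      using Y_mem \<omega> n by (intro convex_mean_mem convex_on_imp_convex[OF g_convex]) auto
    moreover have "(\<Sum>i=1..n. ?Y i \<omega>) = (\<Sum>i=1..n. f (\<xi> i \<omega>))"
      using assms(8) \<omega> by (intro sum.cong) (auto simp: F_def)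
    ultimately show ?thesis by (simp add: quasi_arithmetic_mean_def g_def)
  qed
  define E where "E n = ext_expectation M
      (\<lambda>\<omega>. L (quasi_arithmetic_mean I f n (\<lambda>i. \<xi> i \<omega>)))" for n
  have E_eq: "E n = ext_expectation M (\<lambda>\<omega>. g ((\<Sum>i=1..n. ?Y i \<omega>) / real n))" if "n \<ge> 1" for n
    unfolding E_def using eq that by (intro ext_expectation_cong) auto
  have step: "E (Suc n) \<le> E n" if "n \<ge> 1" for n
    using ext_expectation_convex_mean_Suc_le[OF Y_ex Y_meas Y_mem g_convex g_meas Y_fin that]
      E_eq[of n] E_eq[of "Suc n"] that by simp
  have "E n \<le> E m" if "m \<ge> 1" "m \<le> n" for m n
    using that(2,1) by (induction rule: dec_induct) (auto intro: order_trans[OF step])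
  then have "antimono_on {1..} E"
    by (intro monotone_onI) auto
  moreover have "expectation_below_infinity M
      (\<lambda>\<omega>. L (quasi_arithmetic_mean I f n (\<lambda>i. \<xi> i \<omega>)))" if "n \<ge> 1" for n
    using expectation_below_infinity_convex_mean[OF Y_ex Y_meas Y_mem g_convex g_meas Y_fin that]
      eq[OF that] by (simp cong: expectation_below_infinity_cong)
  ultimately show ?thesis
    unfolding E_def by blast
qed

end
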